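(* Let $G$ be a mixed graph with $V_G=\{v_1,v_2,\dots,v_n\}$. Let $G_j$ be the mixed graph obtained from $G$ by taking a new vertex $u$ and joining it with $v_j$ in one of the ways listed below. Then: (i) if $u$ and $v_j$ are joined by exactly one arc, from $v_j$ to $u$, then $P_{\mathcal{I}(G_j)}(x)=x^2P_{\mathcal{I}(G)}(x)-xP_{\mathcal{I}(G)[j]}(x)$; (ii) if they are joined by exactly one arc, from $u$ to $v_j$, then $P_{\mathcal{I}(G_j)}(x)=x^2P_{\mathcal{I}(G)}(x)-xP_{\mathcal{I}(G)[n+j]}(x)$; (iii) if they are joined by exactly one edge, then $P_{\mathcal{I}(G_j)}(x)=x^2P_{\mathcal{I}(G)}(x)-x\{P_{\mathcal{I}(G)[j]}(x)+P_{\mathcal{I}(G)[n+j]}(x)\}+P_{\mathcal{I}(G-v_j)}(x)$; (iv) if they are joined by exactly one arc from $v_j$ to $u$ and exactly one arc from $u$ to $v_j$, then $P_{\mathcal{I}(G_j)}(x)=x^2P_{\mathcal{I}(G)}(x)-x\{P_{\mathcal{I}(G)[j]}(x)+P_{\mathcal{I}(G)[n+j]}(x)\}+P_{\mathcal{I}(G-v_j)}(x)$; (v) if they are joined by exactly one arc from $v_j$ to $u$ and exactly one edge, then $P_{\mathcal{I}(G_j)}(x)=x^2P_{\mathcal{I}(G)}(x)-x\{2P_{\mathcal{I}(G)[j]}(x)+P_{\mathcal{I}(G)[n+j]}(x)+(-1)^nP_{\mathcal{I}(G)[n+j|j]}(x)+(-1)^nP_{\mathcal{I}(G)[j|n+j]}(x)\}+P_{\mathcal{I}(G-v_j)}(x)$;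 (vi) if they are joined by exactly one arc from $u$ to $v_j$ and exactly one edge, then $P_{\mathcal{I}(G_j)}(x)=x^2P_{\mathcal{I}(G)}(x)-x\{P_{\mathcal{I}(G)[j]}(x)+2P_{\mathcal{I}(G)[n+j]}(x)+(-1)^nP_{\mathcal{I}(G)[n+j|j]}(x)+(-1)^nP_{\mathcal{I}(G)[j|n+j]}(x)\}+P_{\mathcal{I}(G-v_j)}(x)$; (vii) if they are joined by exactly one arc from $v_j$ to $u$, exactly one arc from $u$ to $v_j$, and exactly one edge, then $P_{\mathcal{I}(G_j)}(x)=x^2P_{\mathcal{I}(G)}(x)-2x\{P_{\mathcal{I}(G)[j]}(x)+P_{\mathcal{I}(G)[n+j]}(x)+(-1)^nP_{\mathcal{I}(G)[n+j|j]}(x)+(-1)^nP_{\mathcal{I}(G)[j|n+j]}(x)\}$.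
   Context: A mixed graph $G$ has a finite nonempty vertex set $V_G=\{v_1,\dots,v_n\}$, a set $E_G$ of (undirected) edges, each joining an unordered pair of vertices $\{u,v\}$ (a loop if $u=v$), and a set $\vec E_G$ of arcs, each going from $u$ to $v$ for an ordered pair $(u,v)$ of vertices (a directed loop if $u=v$); multiple edges, loops, arcs and directed loops are allowed. The integrated adjacency matrix $\mathcal{I}(G)$, with rows and columns indexed by $v'_1,\dots,v'_n,v''_1,\dots,v''_n$ in this order, is the real symmetric $2n\times 2n$ matrix $\begin{bmatrix}A&D\\ D^T&A\end{bmatrix}$, where $A_{ij}$ ($i\neq j$) is the number of edges joining $v_i$ and $v_j$, $A_{ii}$ is twice the number of loops at $v_i$, and $D_{ij}$ is the number of arcs from $v_i$ to $v_j$. For a square matrix $M$, $P_M(x)=\det(xI-M)$ denotes its characteristic polynomial. For a matrix $M$, $M[i|j]$ denotes the matrix obtained from $M$ by deleting the $i$-th row and the $j$-th column, and $M[i]$ denotes $M[i|i]$. $G-v_j$ is the mixed graph obtained from $G$ by deleting the vertex $v_j$ together with all edges and arcs incident with it.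
   Formalization: In (v)–(vii), P_{I(G)[n+j|j]}(x) and P_{I(G)[j|n+j]}(x) are taken as det((xI−I(G))[n+j|j]) and det((xI−I(G))[j|n+j]), deleting after forming xI−I(G); with the literal det(xI−I(G)[n+j|j]) the formulas are false, e.g. (v) for n=1 and G without edges and arcs. *)

theory Defs
  imports
    "HOL-Library.Multiset"
    "HOL-Library.Uprod"
    "Jordan_Normal_Form.Char_Poly"
begin

text \<open>
  Parallel edges and parallel arcs are recorded by multiplicity. A loop at \<open>a\<close> is the edge
  \<open>Upair a a\<close>, a directed loop is the arc \<open>(a, a)\<close>.
\<close>

record 'v mixed_graph =
  verts :: "'v set"
  edges :: "'v uprod multiset"
  arcs :: "('v \<times> 'v) multiset"

locale wf_mixed_graph =
  fixes G :: "'v mixed_graph"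
  assumes finite_verts: "finite (verts G)"
    and verts_nonempty: "verts G \<noteq> {}"
    and edges_in_verts: "\<And>e. e \<in># edges G \<Longrightarrow> set_uprod e \<subseteq> verts G"
    and arcs_in_verts: "\<And>a b. (a, b) \<in># arcs G \<Longrightarrow> a \<in> verts G \<and> b \<in> verts G"

definition vertex_enum :: "'v mixed_graph \<Rightarrow> 'v list \<Rightarrow> bool" where
  "vertex_enum G vs \<longleftrightarrow> distinct vs \<and> set vs = verts G"

definition edge_entry :: "'v mixed_graph \<Rightarrow> 'v \<Rightarrow> 'v \<Rightarrow> nat" where
  "edge_entry G a b =
    (if a = b then 2 * count (edges G) (Upair a a) else count (edges G) (Upair a b))"

definition edge_matrix :: "'v mixed_graph \<Rightarrow> 'v list \<Rightarrow> real mat" where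
  "edge_matrix G vs =
    mat (length vs) (length vs) (\<lambda>(i, k). real (edge_entry G (vs ! i) (vs ! k)))"

definition arc_matrix :: "'v mixed_graph \<Rightarrow> 'v list \<Rightarrow> real mat" where
  "arc_matrix G vs =
    mat (length vs) (length vs) (\<lambda>(i, k). real (count (arcs G) (vs ! i, vs ! k)))"

text \<open>
  With 0-based positions and \<open>n = length vs\<close>, the vertex \<open>vs ! j\<close> owns the rows and columns
  \<open>j\<close> and \<open>n + j\<close>.
\<close>

definition integrated_adjacency :: "'v mixed_graph \<Rightarrow> 'v list \<Rightarrow> real mat" where
  "integrated_adjacency G vs =
    four_block_mat (edge_matrix G vs) (arc_matrix G vs)
      (transpose_mat (arc_matrix G vs)) (edge_matrix G vs)"

definition delete_vertex :: "'v mixed_graph \<Rightarrow> 'v \<Rightarrow> 'v mixed_graph" where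
  "delete_vertex G v =
    \<lparr>verts = verts G - {v},
     edges = filter_mset (\<lambda>e. v \<notin> set_uprod e) (edges G),
     arcs = filter_mset (\<lambda>(a, b). a \<noteq> v \<and> b \<noteq> v) (arcs G)\<rparr>"

definition add_vertex ::
  "'v mixed_graph \<Rightarrow> 'v \<Rightarrow> 'v uprod multiset \<Rightarrow> ('v \<times> 'v) multiset \<Rightarrow> 'v mixed_graph" where
  "add_vertex G u E A =
    \<lparr>verts = insert u (verts G), edges = edges G + E, arcs = arcs G + A\<rparr>"

text \<open>
  The polynomial of the submatrix \<open>M[i|j]\<close>. The row and the column are deleted from
  \<open>x I - M\<close>, so that the entries of \<open>M[i|j]\<close> keep the row and column labels they have in
  \<open>M\<close> and \<open>x\<close> stays at the positions whose two labels agree. For \<open>i \<noteq> j\<close> this is not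
  \<open>char_poly (mat_delete M i j)\<close>, where deletion has shifted the labels of the diagonal;
  for \<open>i = j\<close> the two coincide.
\<close>

definition char_poly_minor :: "'a :: comm_ring_1 mat \<Rightarrow> nat \<Rightarrow> nat \<Rightarrow> 'a poly" where
  "char_poly_minor M i j = det (mat_delete (char_poly_matrix M) i j)"

lemma char_poly_minor_same:
  assumes "M \<in> carrier_mat m m" and "i < m"
  shows "char_poly_minor M i i = char_poly (mat_delete M i i)"
proof -
  have "mat_delete (char_poly_matrix M) i i = char_poly_matrix (mat_delete M i i)"
    using assms by (intro eq_matI) (auto simp: char_poly_matrix_def mat_delete_def)
  then show ?thesis
    by (simp add: char_poly_minor_def char_poly_def)
qed

end

theory Submission
  imports Defs
begin

text \<open>
  Order the rows and columns of the matrix of the enlarged graph so that the two copies \<open>u'\<close>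
  and \<open>u''\<close> of the new vertex come last. Its characteristic matrix is then the characteristic
  matrix \<open>N\<close> of \<open>G\<close>, bordered by two rows and two columns. The corner is \<open>x\<close> times the identity,
  since \<open>u\<close> has neither loops nor directed loops, and the border vanishes except at the two copies \<open>v'\<close> and \<open>v''\<close> of
  \<open>v\<close>. Taking a Schur complement with respect to the corner turns the determinant into that of
  \<open>N\<close> with a correction in the rows of \<open>v'\<close> and \<open>v''\<close> (\<open>det_bordered_by_two\<close>), and multilinearity
  in these two rows gives the terms of the formula (\<open>det_update_two_rows\<close>): \<open>x\<^sup>2\<close> times the
  polynomial of \<open>G\<close>, then \<open>- x\<close> times cofactors of \<open>N\<close> at the copies of \<open>v\<close>, and finally a
  multiple of the minor without both copies, which is the polynomial of \<open>G - v\<close>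
  (\<open>char_poly_delete_vertex\<close>).

  The coefficients depend only on the numbers of edges and arcs between \<open>u\<close> and \<open>v\<close>, so a single
  formula (\<open>char_poly_add_vertex\<close>) covers every way of joining them, and the seven parts of the
  theorem are instances. The term of \<open>G - v\<close> is absent exactly when \<open>e\<^sup>2 = a b\<close>, for \<open>e\<close> edges
  and \<open>a\<close> and \<open>b\<close> arcs in the two directions.
\<close>

section \<open>Determinants of matrices bordered by two rows and columns\<close>

text \<open>
  Determinants are expanded along two rows by swapping these rows for others; keeping the new
  row as a function of the column index makes linear combinations of rows easy to write.
\<close>

definition replace_row :: "'a mat \<Rightarrow> nat \<Rightarrow> (nat \<Rightarrow> 'a) \<Rightarrow> 'a mat" where
  "replace_row N p r =
    mat (dim_row N) (dim_col N) (\<lambda>(i, k). if i = p then r k else N $$ (i, k))"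

abbreviation unit_row :: "nat \<Rightarrow> nat \<Rightarrow> 'a :: comm_ring_1" where
  "unit_row c \<equiv> (\<lambda>k. if k = c then 1 else 0)"

lemma replace_row_carrier [simp]:
  "N \<in> carrier_mat m l \<Longrightarrow> replace_row N p r \<in> carrier_mat m l"
  by (simp add: replace_row_def)

lemma replace_row_dim [simp]:
  "dim_row (replace_row N p r) = dim_row N" "dim_col (replace_row N p r) = dim_col N"
  by (simp_all add: replace_row_def)

lemma replace_row_index [simp]:
  "i < dim_row N \<Longrightarrow> k < dim_col N \<Longrightarrow>
    replace_row N p r $$ (i, k) = (if i = p then r k else N $$ (i, k))"
  by (auto simp: replace_row_def)

lemma replace_row_commute:
  "p \<noteq> q \<Longrightarrow> replace_row (replace_row N q s) p r = replace_row (replace_row N p r) q s"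
  by (rule eq_matI) (auto simp: replace_row_def)

lemma det_replace_row:
  fixes N :: "'a :: comm_ring_1 mat"
  assumes N: "N \<in> carrier_mat m m" and p: "p < m"
  shows "det (replace_row N p r) = (\<Sum>k<m. r k * cofactor N p k)"
proof -
  have "mat_delete (replace_row N p r) p k = mat_delete N p k" if "k < m" for k
    using N p that by (intro eq_matI) (auto simp: mat_delete_def replace_row_def)
  then show ?thesis
    using laplace_expansion_row[OF replace_row_carrier[OF N], OF p] N p
    by (simp add: cofactor_def)
qed

text \<open>
  Laplace expansion along the unit row leaves one term. Reading cofactors as determinants in
  this way lets the expansion be repeated inside a cofactor.
\<close>

lemma cofactor_eq_det_unit_row:
  fixes N :: "'a :: comm_ring_1 mat"
  assumes "N \<in> carrier_mat m m" "p < m" "c < m"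
  shows "cofactor N p c = det (replace_row N p (unit_row c))"
  using assms by (simp add: det_replace_row sum.delta if_distrib[where f="\<lambda>t. t * _"] cong: if_cong)

text \<open>
  Linearity of the determinant in one row, for the shape of row that arises below: a multiple
  of the old row, corrected at two positions only.
\<close>

lemma det_replace_row_rank_one:
  fixes N :: "'a :: comm_ring_1 mat"
  assumes N: "N \<in> carrier_mat m m" and p: "p < m" "c < m" "d < m"
    and r: "\<And>k. k < m \<Longrightarrow> r k = x * N $$ (p, k) - a * unit_row c k - b * unit_row d k"
  shows "det (replace_row N p r) = x * det N - a * cofactor N p c - b * cofactor N p d"
proof -
  have "det (replace_row N p r)
      = (\<Sum>k<m. (x * N $$ (p, k) - a * unit_row c k - b * unit_row d k) * cofactor N p k)"
    unfolding det_replace_row[OF N p(1)] by (rule sum.cong) (simp_all add: r)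
  also have "\<dots> = (\<Sum>k<m. x * (N $$ (p, k) * cofactor N p k))
      - (\<Sum>k<m. if k = c then a * cofactor N p k else 0)
      - (\<Sum>k<m. if k = d then b * cofactor N p k else 0)"
    unfolding sum_subtractf[symmetric] by (rule sum.cong) (auto simp: algebra_simps)
  also have "\<dots> = x * det N - a * cofactor N p c - b * cofactor N p d"
    using p laplace_expansion_row[OF N p(1)] by (simp add: sum_distrib_left)
  finally show ?thesis .
qed

lemma det_two_unit_rows:
  fixes N :: "'a :: comm_ring_1 mat"
  assumes N: "N \<in> carrier_mat m m" and pq: "p < q" "q < m"
  shows "cofactor (replace_row N p (unit_row p)) q q = det (mat_delete (mat_delete N q q) p p)"
proof -
  have "mat_delete (replace_row N p (unit_row p)) q q
      = replace_row (mat_delete N q q) p (unit_row p)"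
    using N pq by (intro eq_matI) (auto simp: mat_delete_def replace_row_def)
  moreover have "det (replace_row (mat_delete N q q) p (unit_row p))
      = cofactor (mat_delete N q q) p p"
    using N pq by (subst cofactor_eq_det_unit_row[where m = "m - 1"]) (auto simp: mat_delete_def)
  ultimately show ?thesis by (simp add: cofactor_def)
qed

text \<open>
  Multilinearity in the two rows \<open>p\<close> and \<open>q\<close>. The term of second order picks from each
  row one of the unit rows at \<open>p\<close> and \<open>q\<close>: equal choices give two equal rows and vanish, and
  the two remaining choices differ by a swap of rows. Hence its coefficient is the determinant
  of the matrix of corrections.
\<close>

lemma det_update_two_rows:
  fixes N :: "'a :: comm_ring_1 mat"
  assumes N: "N \<in> carrier_mat m m" and pq: "p < q" "q < m"
    and r: "\<And>k. k < m \<Longrightarrow> r k = x * N $$ (p, k) - a * unit_row p k - b * unit_row q k"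
    and s: "\<And>k. k < m \<Longrightarrow> s k = x * N $$ (q, k) - c * unit_row p k - d * unit_row q k"
  shows "det (replace_row (replace_row N q s) p r) =
      x ^ 2 * det N
      - x * (a * cofactor N p p + b * cofactor N p q + c * cofactor N q p + d * cofactor N q q)
      + (a * d - b * c) * det (mat_delete (mat_delete N q q) p p)"
proof -
  have p: "p < m" and ne: "p \<noteq> q" using pq by auto
  let ?U = "\<lambda>i. replace_row N p (unit_row i)"
  \<comment> \<open>A cofactor along row \<open>p\<close> still contains the new row \<open>q\<close>, which is expanded in turn.\<close>
  have cof: "cofactor (replace_row N q s) p i
      = x * cofactor N p i - c * cofactor (?U i) q p - d * cofactor (?U i) q q" if i: "i < m" for i
  proof -
    have "cofactor (replace_row N q s) p i = det (replace_row (?U i) q s)"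
      using N p i ne by (simp add: cofactor_eq_det_unit_row[where m = m] replace_row_commute)
    also have "\<dots> = x * det (?U i) - c * cofactor (?U i) q p - d * cofactor (?U i) q q"
      by (rule det_replace_row_rank_one[where m = m]) (use N p pq s ne in auto)
    finally show ?thesis using N p i by (simp add: cofactor_eq_det_unit_row[where m = m])
  qed
  have same: "cofactor (?U i) q i = 0" if i: "i < m" for i
  proof -
    have "det (replace_row (?U i) q (unit_row i)) = 0"
      by (rule det_identical_rows[where n = m and i = p and j = q])
        (use N p pq ne in \<open>auto intro!: eq_vecI simp: replace_row_def\<close>)
    then show ?thesis using N i pq by (simp add: cofactor_eq_det_unit_row[where m = m])
  qed
  have swap: "cofactor (?U q) q p = - cofactor (?U p) q q"
  proof -
    have "replace_row (?U q) q (unit_row p) = swaprows p q (replace_row (?U p) q (unit_row q))"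
      using N pq ne by (intro eq_matI) (auto simp: replace_row_def)
    then have "det (replace_row (?U q) q (unit_row p)) = - det (replace_row (?U p) q (unit_row q))"
      using N p pq ne by (simp add: det_swaprows[where n = m])
    then show ?thesis using N p pq by (simp add: cofactor_eq_det_unit_row[where m = m])
  qed
  have "det (replace_row (replace_row N q s) p r)
      = x * det (replace_row N q s) - a * cofactor (replace_row N q s) p p
        - b * cofactor (replace_row N q s) p q"
    by (rule det_replace_row_rank_one[where m = m]) (use N p pq r ne in auto)
  also have "det (replace_row N q s) = x * det N - c * cofactor N q p - d * cofactor N q q"
    by (rule det_replace_row_rank_one[where m = m]) (use N p pq s in auto)
  finally show ?thesis
    using cof[OF p] cof[OF pq(2)] same[OF p] same[OF pq(2)] swap det_two_unit_rows[OF N pq]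
    by (simp add: algebra_simps power2_eq_square)
qed

text \<open>
  A form of the Schur complement that avoids division by \<open>x\<close>. Let \<open>S\<close> be the diagonal matrix
  with \<open>x\<close> at \<open>p\<close> and \<open>q\<close> and 1 elsewhere. As \<open>C\<close> lives in the rows \<open>p\<close> and \<open>q\<close>, we have
  \<open>S C = x C\<close>, so the block matrix with rows \<open>(S, - C)\<close> and \<open>(0, 1)\<close> times the bordered matrix
  is block lower triangular with diagonal blocks \<open>S N - C R\<close> and \<open>x 1\<close>. Both \<open>det S\<close> and
  \<open>det (x 1)\<close> equal \<open>x\<^sup>2\<close> and cancel. What is left, \<open>det (S N - C R)\<close>, differs from
  \<open>det N\<close> in the rows \<open>p\<close> and \<open>q\<close> only.
\<close>

lemma det_bordered_by_two:
  fixes N :: "'a :: idom mat"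
  assumes N: "N \<in> carrier_mat m m" and pq: "p < q" "q < m" and x: "x \<noteq> 0"
    and C: "C \<in> carrier_mat m 2" and R: "R \<in> carrier_mat 2 m"
    and C0: "\<And>i k. i < m \<Longrightarrow> k < 2 \<Longrightarrow> i \<noteq> p \<Longrightarrow> i \<noteq> q \<Longrightarrow> C $$ (i, k) = 0"
    and R0: "\<And>i k. i < m \<Longrightarrow> k < 2 \<Longrightarrow> i \<noteq> p \<Longrightarrow> i \<noteq> q \<Longrightarrow> R $$ (k, i) = 0"
    and K: "\<And>i l. K i l = C $$ (i, 0) * R $$ (0, l) + C $$ (i, 1) * R $$ (1, l)"
  shows "det (four_block_mat N C R (x \<cdot>\<^sub>m 1\<^sub>m 2)) =
      x ^ 2 * det N
      - x * (K p p * cofactor N p p + K p q * cofactor N p q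
             + K q p * cofactor N q p + K q q * cofactor N q q)
      + (K p p * K q q - K p q * K q p) * det (mat_delete (mat_delete N q q) p p)"
proof -
  have p: "p < m" and ne: "p \<noteq> q" using pq by auto
  define S where "S = multrow p x (multrow q x (1\<^sub>m m))"
  have S: "S \<in> carrier_mat m m" by (simp add: S_def)
  have S_ix: "S $$ (i, k) = (if i = k then (if i = p \<or> i = q then x else 1) else 0)"
    if "i < m" "k < m" for i k
    using that ne by (auto simp: S_def)
  have S_row: "(\<Sum>l = 0..<m. S $$ (i, l) * f l) = (if i = p \<or> i = q then x else 1) * f i"
    if i: "i < m" for i f
  proof -
    have "(\<Sum>l = 0..<m. S $$ (i, l) * f l)
        = (\<Sum>l = 0..<m. if l = i then (if i = p \<or> i = q then x else 1) * f l else 0)"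
      by (rule sum.cong) (use i in \<open>auto simp: S_ix\<close>)
    then show ?thesis using i by simp
  qed
  have det_S: "det S = x ^ 2"
    using pq p by (simp add: S_def det_multrow[where n = m] power2_eq_square)
  let ?X = "x \<cdot>\<^sub>m 1\<^sub>m 2 :: 'a mat"
  let ?B = "four_block_mat N C R ?X"
  let ?T = "four_block_mat S (- C) (0\<^sub>m 2 m) (1\<^sub>m 2)"
  let ?r = "\<lambda>i k. x * N $$ (i, k) - K i p * unit_row p k - K i q * unit_row q k"
  have det_X: "det ?X = x ^ 2" by simp
  have "?T * ?B = four_block_mat (S * N + - C * R) (S * C + - C * ?X)
      (0\<^sub>m 2 m * N + 1\<^sub>m 2 * R) (0\<^sub>m 2 m * C + 1\<^sub>m 2 * ?X)"
    by (rule mult_four_block_mat) (use S C N R in auto)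
  moreover have "S * N + - C * R = replace_row (replace_row N q (?r q)) p (?r p)"
    (is "?L = ?Q")
  proof (rule eq_matI)
    fix i k assume "i < dim_row ?Q" "k < dim_col ?Q"
    then have ik: "i < m" "k < m" using N by (auto simp: replace_row_def)
    have "?L $$ (i, k) = (\<Sum>l = 0..<m. S $$ (i, l) * N $$ (l, k)) - K i k"
      using ik S N C R by (simp add: scalar_prod_def K numeral_2_eq_2)
    then show "?L $$ (i, k) = ?Q $$ (i, k)"
      using ik N ne S_row[OF ik(1), of "\<lambda>l. N $$ (l, k)"] C0[OF ik(1)] R0[OF ik(2)]
      by (auto simp: K)
  qed (use S N C R in \<open>auto simp: replace_row_def\<close>)
  moreover have "S * C + - C * ?X = 0\<^sub>m m 2" (is "?L = _")
  proof (rule eq_matI)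
    fix i k assume "i < dim_row (0\<^sub>m m 2 :: 'a mat)" "k < dim_col (0\<^sub>m m 2 :: 'a mat)"
    then have ik: "i < m" "k < 2" by auto
    have "?L $$ (i, k) = (\<Sum>l = 0..<m. S $$ (i, l) * C $$ (l, k)) - x * C $$ (i, k)"
      using ik S C by (auto simp: scalar_prod_def numeral_2_eq_2 less_Suc_eq)
    then show "?L $$ (i, k) = 0\<^sub>m m 2 $$ (i, k)"
      using ik S_row[OF ik(1), of "\<lambda>l. C $$ (l, k)"] C0[OF ik] by auto
  qed (use S C in auto)
  moreover have "0\<^sub>m 2 m * N + 1\<^sub>m 2 * R = R" "0\<^sub>m 2 m * C + 1\<^sub>m 2 * ?X = ?X"
    using N C R by auto
  ultimately have prod: "?T * ?B
      = four_block_mat (replace_row (replace_row N q (?r q)) p (?r p)) (0\<^sub>m m 2) R ?X"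
    by simp
  have "det ?T * det ?B = det (?T * ?B)"
    by (rule det_mult[where n = "m + 2", symmetric]) (use S N C R in auto)
  also have "\<dots> = det (replace_row (replace_row N q (?r q)) p (?r p)) * x ^ 2"
    unfolding prod
    by (subst det_four_block_mat_upper_right_zero[where n = m and m = 2]) (use N R det_X in auto)
  also have "det ?T = x ^ 2"
    using det_four_block_mat_lower_left_zero[OF S, of "- C" 2 "0\<^sub>m 2 m" "1\<^sub>m 2"] C det_S
    by simp
  finally have "det ?B = det (replace_row (replace_row N q (?r q)) p (?r p))"
    using x by simp
  also have "\<dots> = x ^ 2 * det N
      - x * (K p p * cofactor N p p + K p q * cofactor N p q
             + K q p * cofactor N q p + K q q * cofactor N q q)
      + (K p p * K q q - K p q * K q p) * det (mat_delete (mat_delete N q q) p p)"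
    by (rule det_update_two_rows[OF N pq]) auto
  finally show ?thesis .
qed

section \<open>Matrices indexed by labels\<close>

text \<open>
  The sign of the permutation enters once for the rows and once for the columns.
\<close>

lemma det_permute_indices:
  fixes A :: "'a :: comm_ring_1 mat"
  assumes A: "A \<in> carrier_mat m m" and p: "p permutes {..<m}"
  shows "det (mat m m (\<lambda>(i, k). A $$ (p i, p k))) = det A"
proof -
  have p': "p permutes {0..<m}" using p by (simp add: lessThan_atLeast0)
  have lt: "p i < m" if "i < m" for i
    using permutes_in_image[OF p, of i] that by simp
  let ?B = "transpose_mat (mat m m (\<lambda>(i, k). A $$ (p i, k)))"
  have "mat m m (\<lambda>(i, k). A $$ (p i, p k)) = transpose_mat (mat m m (\<lambda>(i, k). ?B $$ (p i, k)))"
    using A lt by (intro eq_matI) auto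
  then have "det (mat m m (\<lambda>(i, k). A $$ (p i, p k))) = signof p * det ?B"
    using det_permute_rows[OF _ p', of ?B] by (simp add: det_transpose[where n = m])
  also have "det ?B = signof p * det A"
    using det_permute_rows[OF A p'] by (simp add: det_transpose[where n = m])
  also have "signof p * (signof p * det A) = det A"
    by (simp add: sign_def)
  finally show ?thesis .
qed

text \<open>
  Matrices whose rows and columns carry labels, where an entry depends only on the two labels.
  Reordering or deleting vertices then becomes reordering or deleting labels.
\<close>

definition list_mat :: "('l \<Rightarrow> 'l \<Rightarrow> 'a) \<Rightarrow> 'l list \<Rightarrow> 'a mat" where
  "list_mat g L = mat (length L) (length L) (\<lambda>(i, k). g (L ! i) (L ! k))"

lemma list_mat_carrier [simp]: "list_mat g L \<in> carrier_mat (length L) (length L)"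
  by (simp add: list_mat_def)

lemma list_mat_cong:
  "(\<And>a b. a \<in> set L \<Longrightarrow> b \<in> set L \<Longrightarrow> g a b = h a b) \<Longrightarrow> list_mat g L = list_mat h L"
  by (rule eq_matI) (auto simp: list_mat_def)

lemma char_poly_list_mat_mset:
  assumes "mset L = mset L'"
  shows "char_poly (list_mat g L) = char_poly (list_mat g L')"
proof -
  obtain p where p: "p permutes {..<length L'}" and L: "permute_list p L' = L"
    using mset_eq_permutation[OF assms] .
  have len: "length L = length L'" using L by auto
  have nth: "L ! i = L' ! p i" if "i < length L'" for i
    using permute_list_nth[OF p that] L by simp
  have lt: "p i < length L'" if "i < length L'" for i
    using permutes_in_image[OF p, of i] that by simp
  have inj: "p i = p k \<longleftrightarrow> i = k" for i k
    using permutes_inj[OF p] by (auto simp: inj_def)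
  have "char_poly_matrix (list_mat g L) = mat (length L') (length L')
      (\<lambda>(i, k). char_poly_matrix (list_mat g L') $$ (p i, p k))"
    by (rule eq_matI) (auto simp: char_poly_matrix_def list_mat_def len nth lt inj)
  then show ?thesis
    using det_permute_indices[OF _ p, of "char_poly_matrix (list_mat g L')"]
    by (simp add: char_poly_def)
qed

lemma mat_delete_list_mat:
  assumes "i < length L"
  shows "mat_delete (list_mat g L) i i = list_mat g (take i L @ drop (Suc i) L)"
  using assms
  by (intro eq_matI) (auto simp: mat_delete_def list_mat_def nth_append min_def not_less Suc_le_eq)

lemma mset_delete_nth:
  assumes "i < length L"
  shows "mset (take i L @ drop (Suc i) L) = mset L - {#L ! i#}"
  by (subst (3) id_take_nth_drop[OF assms]) simp

lemma char_poly_matrix_mat_delete: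
  fixes A :: "'a :: comm_ring_1 mat"
  assumes "A \<in> carrier_mat m m" "i < m"
  shows "mat_delete (char_poly_matrix A) i i = char_poly_matrix (mat_delete A i i)"
  using assms by (intro eq_matI) (auto simp: char_poly_matrix_def mat_delete_def)

section \<open>The integrated adjacency matrix\<close>

text \<open>
  The label \<open>(True, a)\<close> stands for the first copy \<open>a'\<close> of the vertex \<open>a\<close>, and
  \<open>(False, a)\<close> for the second copy \<open>a''\<close>.
\<close>

definition vertex_labels :: "'v list \<Rightarrow> (bool \<times> 'v) list" where
  "vertex_labels vs = map (Pair True) vs @ map (Pair False) vs"

definition label_entry :: "'v mixed_graph \<Rightarrow> bool \<times> 'v \<Rightarrow> bool \<times> 'v \<Rightarrow> real" where
  "label_entry G = (\<lambda>(s, a) (t, b). real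
    (if s = t then edge_entry G a b else if s then count (arcs G) (a, b) else count (arcs G) (b, a)))"

lemma edge_entry_sym: "edge_entry G a b = edge_entry G b a"
proof -
  have "Upair a b = Upair b a" by simp
  then show ?thesis unfolding edge_entry_def by metis
qed

lemma label_entry_sym: "label_entry G p q = label_entry G q p"
  by (cases p; cases q) (auto simp: label_entry_def edge_entry_sym)

lemma length_vertex_labels [simp]: "length (vertex_labels vs) = 2 * length vs"
  by (simp add: vertex_labels_def)

lemma nth_vertex_labels:
  "i < 2 * length vs \<Longrightarrow> vertex_labels vs ! i
    = (if i < length vs then (True, vs ! i) else (False, vs ! (i - length vs)))"
  by (auto simp: vertex_labels_def nth_append)

lemma integrated_adjacency_list_mat:
  "integrated_adjacency G vs = list_mat (label_entry G) (vertex_labels vs)"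
proof (rule eq_matI)
  fix i k
  assume "i < dim_row (list_mat (label_entry G) (vertex_labels vs))"
    "k < dim_col (list_mat (label_entry G) (vertex_labels vs))"
  then have "i < 2 * length vs" "k < 2 * length vs" by (simp_all add: list_mat_def)
  then show "integrated_adjacency G vs $$ (i, k)
      = list_mat (label_entry G) (vertex_labels vs) $$ (i, k)"
    by (cases "i < length vs"; cases "k < length vs")
      (simp_all add: integrated_adjacency_def list_mat_def edge_matrix_def arc_matrix_def
        nth_vertex_labels label_entry_def)
qed (simp_all add: integrated_adjacency_def list_mat_def edge_matrix_def)

text \<open>
  Characteristic polynomials do not depend on the enumeration of the vertices, since all
  enumerations have the same labels up to order.
\<close>

lemma mset_vertex_labels_enum:
  assumes "vertex_enum G vs" "set ws = verts G" "distinct ws"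
  shows "mset (vertex_labels vs) = mset (vertex_labels ws)"
proof -
  have "mset vs = mset ws"
    using assms by (simp add: vertex_enum_def set_eq_iff_mset_eq_distinct[symmetric])
  then show ?thesis by (simp add: vertex_labels_def)
qed

lemma set_vertex_labels: "set (vertex_labels vs) = UNIV \<times> set vs"
  unfolding vertex_labels_def UNIV_bool by auto

lemma label_entry_delete_vertex:
  assumes "snd p \<noteq> v" "snd q \<noteq> v"
  shows "label_entry (delete_vertex G v) p q = label_entry G p q"
  using assms by (cases p; cases q) (simp add: label_entry_def edge_entry_def delete_vertex_def)

text \<open>
  Deleting \<open>vs ! j\<close> removes its two labels and changes no entry between the others. The later
  index \<open>n + j\<close> is removed first, so that \<open>j\<close> still denotes the same label afterwards.
\<close>

lemma char_poly_delete_vertex: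
  assumes vs: "vertex_enum G vs" and j: "j < length vs"
    and us: "vertex_enum (delete_vertex G (vs ! j)) us"
  defines "n \<equiv> length vs" and "M \<equiv> integrated_adjacency G vs"
  shows "char_poly (integrated_adjacency (delete_vertex G (vs ! j)) us)
    = char_poly (mat_delete (mat_delete M (n + j) (n + j)) j j)"
proof -
  let ?v = "vs ! j" and ?L = "vertex_labels vs"
  let ?L1 = "take (n + j) ?L @ drop (Suc (n + j)) ?L"
  let ?L2 = "take j ?L1 @ drop (Suc j) ?L1"
  have jn: "j < n" and ne: "vs \<noteq> []" using j by (auto simp: n_def)
  have vs_us: "mset vs = add_mset ?v (mset us)"
  proof -
    have "distinct (?v # us)" "set (?v # us) = set vs"
      using us vs nth_mem[OF j] by (auto simp: vertex_enum_def delete_vertex_def)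
    moreover have "distinct vs" using vs by (simp add: vertex_enum_def)
    ultimately have "mset (?v # us) = mset vs"
      using set_eq_iff_mset_eq_distinct by blast
    then show ?thesis by simp
  qed
  have "mset ?L1 = mset ?L - {#?L ! (n + j)#}"
    by (rule mset_delete_nth) (use jn in \<open>simp add: n_def\<close>)
  moreover have "?L ! (n + j) = (False, ?v)" "?L1 ! j = (True, ?v)"
    using jn ne by (simp_all add: nth_append nth_vertex_labels n_def)
  moreover have "mset ?L2 = mset ?L1 - {#?L1 ! j#}"
    by (rule mset_delete_nth) (use jn in \<open>simp add: n_def\<close>)
  moreover have "mset ?L = add_mset (False, ?v) (add_mset (True, ?v) (mset (vertex_labels us)))"
    by (simp add: vertex_labels_def vs_us)
  ultimately have labels: "mset (vertex_labels us) = mset ?L2"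
    by (simp only: add_mset_remove_trivial)
  have "mat_delete M (n + j) (n + j) = list_mat (label_entry G) ?L1"
    unfolding M_def integrated_adjacency_list_mat
    by (rule mat_delete_list_mat) (use jn in \<open>simp add: n_def\<close>)
  moreover have "mat_delete (list_mat (label_entry G) ?L1) j j = list_mat (label_entry G) ?L2"
    by (rule mat_delete_list_mat) (use jn in \<open>simp add: n_def\<close>)
  ultimately have del: "mat_delete (mat_delete M (n + j) (n + j)) j j
      = list_mat (label_entry G) ?L2"
    by (simp only:)
  have "list_mat (label_entry (delete_vertex G ?v)) (vertex_labels us)
      = list_mat (label_entry G) (vertex_labels us)"
  proof (rule list_mat_cong, rule label_entry_delete_vertex)
    have "?v \<notin> set us" using us by (simp add: vertex_enum_def delete_vertex_def)
    then have "snd p \<noteq> ?v" if "p \<in> set (vertex_labels us)" for p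
      using that unfolding set_vertex_labels by (metis mem_Times_iff)
    then show "snd p \<noteq> ?v" "snd q \<noteq> ?v"
      if "p \<in> set (vertex_labels us)" "q \<in> set (vertex_labels us)" for p q
      using that by blast+
  qed
  then show ?thesis
    unfolding del integrated_adjacency_list_mat
    using char_poly_list_mat_mset[OF labels, of "label_entry G"] by (simp only:)
qed

section \<open>Joining a new vertex\<close>

lemma label_entry_new_vertex:
  assumes wf: "wf_mixed_graph G" and u: "u \<notin> verts G" and v: "v \<in> verts G" and w: "w \<in> verts G"
  shows "label_entry (add_vertex G u (replicate_mset e (Upair u v))
        (replicate_mset a (v, u) + replicate_mset b (u, v))) (s, w) (t, u)
    = (if w = v then real (if s = t then e else if s then a else b) else 0)"
    "label_entry (add_vertex G u (replicate_mset e (Upair u v))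
        (replicate_mset a (v, u) + replicate_mset b (u, v))) (s, u) (t, u) = 0"
proof -
  interpret wf_mixed_graph G by (rule wf)
  have ne: "u \<noteq> v" "u \<noteq> w" "v \<noteq> u" "w \<noteq> u" using u v w by auto
  have "Upair y u \<notin># edges G" "(y, u) \<notin># arcs G" "(u, y) \<notin># arcs G" for y
    using u edges_in_verts[of "Upair y u"] arcs_in_verts by auto
  then have zero: "count (edges G) (Upair y u) = 0" "count (arcs G) (y, u) = 0"
    "count (arcs G) (u, y) = 0" for y
    by (simp_all add: count_eq_zero_iff)
  show "label_entry (add_vertex G u (replicate_mset e (Upair u v))
        (replicate_mset a (v, u) + replicate_mset b (u, v))) (s, w) (t, u)
    = (if w = v then real (if s = t then e else if s then a else b) else 0)"
    using ne by (simp add: label_entry_def edge_entry_def add_vertex_def zero)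
  show "label_entry (add_vertex G u (replicate_mset e (Upair u v))
        (replicate_mset a (v, u) + replicate_mset b (u, v))) (s, u) (t, u) = 0"
    using ne by (simp add: label_entry_def edge_entry_def add_vertex_def zero)
qed

lemma label_entry_old_vertices:
  assumes "u \<notin> verts G" "w \<in> verts G" "y \<in> verts G"
  shows "label_entry (add_vertex G u (replicate_mset e (Upair u v))
        (replicate_mset a (v, u) + replicate_mset b (u, v))) (s, w) (t, y)
    = label_entry G (s, w) (t, y)"
proof -
  have "u \<noteq> w" "u \<noteq> y" using assms by auto
  then show ?thesis by (simp add: label_entry_def edge_entry_def add_vertex_def)
qed

text \<open>
  One formula for all ways of joining \<open>u\<close> to \<open>v\<close>: by \<open>e\<close> edges, \<open>a\<close> arcs from \<open>v\<close> to \<open>u\<close>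
  and \<open>b\<close> arcs from \<open>u\<close> to \<open>v\<close>. The columns of the new labels \<open>u'\<close> and \<open>u''\<close> have the entries
  \<open>(e, b)\<close> and \<open>(a, e)\<close> at \<open>(v', v'')\<close>. With \<open>B\<close> the 2 by 2 matrix formed by these columns, the
  coefficients of \<open>- x\<close> are the entries of \<open>B B\<^sup>T\<close>, and the last coefficient is
  \<open>det (B B\<^sup>T) = (det B)\<^sup>2\<close>.
\<close>

theorem char_poly_add_vertex:
  fixes G :: "'v mixed_graph"
  assumes wf: "wf_mixed_graph G" and vs: "vertex_enum G vs" and j: "j < length vs"
    and u: "u \<notin> verts G"
    and ws: "vertex_enum (add_vertex G u (replicate_mset e (Upair u (vs ! j)))
        (replicate_mset a (vs ! j, u) + replicate_mset b (u, vs ! j))) ws"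
  defines "n \<equiv> length vs" and "M \<equiv> integrated_adjacency G vs" and "x \<equiv> [:0, 1:] :: real poly"
  shows "char_poly (integrated_adjacency
        (add_vertex G u (replicate_mset e (Upair u (vs ! j)))
          (replicate_mset a (vs ! j, u) + replicate_mset b (u, vs ! j))) ws) =
      x ^ 2 * char_poly M
      - x * (of_nat (e ^ 2 + a ^ 2) * char_poly (mat_delete M j j)
             + of_nat (e ^ 2 + b ^ 2) * char_poly (mat_delete M (n + j) (n + j))
             + of_nat (e * (a + b)) * ((-1) ^ n * char_poly_minor M (n + j) j
                                     + (-1) ^ n * char_poly_minor M j (n + j)))
      + (of_nat (e ^ 2) - of_nat (a * b)) ^ 2
        * char_poly (mat_delete (mat_delete M (n + j) (n + j)) j j)"
proof -
  let ?v = "vs ! j"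
  define H where "H = add_vertex G u (replicate_mset e (Upair u ?v))
    (replicate_mset a (?v, u) + replicate_mset b (u, ?v))"
  define L where "L = vertex_labels vs"
  define N where "N = char_poly_matrix M"
  define C where "C = mat (2 * n) 2 (\<lambda>(i, k). - [:label_entry H (L ! i) (k = 0, u):])"
  have jn: "j < n" using j by (simp add: n_def)
  have set_vs: "set vs = verts G" "distinct vs" using vs by (auto simp: vertex_enum_def)
  have vG: "?v \<in> verts G" using nth_mem[OF j] set_vs by simp
  have lenL: "length L = 2 * n" by (simp add: L_def n_def)
  have M: "M \<in> carrier_mat (2 * n) (2 * n)"
    by (simp add: M_def integrated_adjacency_list_mat n_def list_mat_def)
  then have N: "N \<in> carrier_mat (2 * n) (2 * n)" by (simp add: N_def)
  have vs_verts: "vs ! i \<in> verts G" if "i < n" for i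
    using that nth_mem[of i vs] set_vs by (simp add: n_def)
  have L_verts: "snd (L ! i) \<in> verts G" if "i < 2 * n" for i
    using that vs_verts[of i] vs_verts[of "i - n"] by (simp add: L_def n_def nth_vertex_labels)
  have L_v: "snd (L ! i) = ?v \<longleftrightarrow> i = j \<or> i = n + j" if i: "i < 2 * n" for i
  proof (cases "i < n")
    case True
    then show ?thesis
      using jn set_vs by (simp add: L_def n_def nth_vertex_labels nth_eq_iff_index_eq)
  next
    case False
    then have "vs ! (i - n) = ?v \<longleftrightarrow> i - n = j"
      using i jn set_vs by (simp add: n_def nth_eq_iff_index_eq)
    with False i jn show ?thesis by (auto simp: L_def n_def nth_vertex_labels)
  qed
  have new: "label_entry H (L ! i) (t, u)
      = (if snd (L ! i) = ?v then real (if fst (L ! i) = t then e else if fst (L ! i) then a else b) else 0)"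
    if "i < 2 * n" for i t
    using label_entry_new_vertex(1)[OF wf u vG L_verts[OF that], where s = "fst (L ! i)"]
    by (simp add: H_def)
  have old: "label_entry H (L ! i) (L ! k) = label_entry G (L ! i) (L ! k)"
    if "i < 2 * n" "k < 2 * n" for i k
    using label_entry_old_vertices[OF u L_verts[OF that(1)] L_verts[OF that(2)],
        where s = "fst (L ! i)" and t = "fst (L ! k)"]
    by (simp add: H_def)
  have uu: "label_entry H (s, u) (t, u) = 0" for s t
    using label_entry_new_vertex(2)[OF wf u vG vG] by (simp add: H_def)
  \<comment> \<open>The enumeration \<open>ws\<close> is arbitrary; the labels of \<open>u\<close> are moved to the end to obtain a
    bordered matrix.\<close>
  have "set (vs @ [u]) = verts H" "distinct (vs @ [u])"
    using set_vs u by (auto simp: H_def add_vertex_def)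
  then have "mset (vertex_labels ws) = mset (vertex_labels (vs @ [u]))"
    using ws by (intro mset_vertex_labels_enum) (auto simp: H_def)
  then have "mset (vertex_labels ws) = mset (L @ [(True, u), (False, u)])"
    by (simp add: vertex_labels_def L_def)
  then have "char_poly (integrated_adjacency H ws)
      = char_poly (list_mat (label_entry H) (L @ [(True, u), (False, u)]))"
    unfolding integrated_adjacency_list_mat by (rule char_poly_list_mat_mset)
  also have "\<dots> = det (four_block_mat N C (transpose_mat C) (x \<cdot>\<^sub>m 1\<^sub>m 2))"
  proof -
    have "char_poly_matrix (list_mat (label_entry H) (L @ [(True, u), (False, u)]))
        = four_block_mat N C (transpose_mat C) (x \<cdot>\<^sub>m 1\<^sub>m 2)" (is "?A = ?B")
    proof (rule eq_matI)
      fix i k assume "i < dim_row ?B" "k < dim_col ?B"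
      then have ik: "i < 2 * n + 2" "k < 2 * n + 2" using N by auto
      have split: "i < 2 * n \<or> i = 2 * n \<or> i = Suc (2 * n)" if "i < 2 * n + 2" for i
        using that by auto
      show "?A $$ (i, k) = ?B $$ (i, k)"
        using split[OF ik(1)] split[OF ik(2)] ik
        by (elim disjE)
          (simp_all add: list_mat_def char_poly_matrix_def N_def M_def C_def x_def lenL nth_append
            integrated_adjacency_list_mat L_def[symmetric] old uu
            label_entry_sym[of H "(_, u)" "L ! _"])
    qed (use N in \<open>simp_all add: C_def lenL list_mat_def char_poly_matrix_def\<close>)
    then show ?thesis by (simp add: char_poly_def)
  qed
  also have "\<dots> = x ^ 2 * det N
      - x * ((of_nat e ^ 2 + of_nat a ^ 2) * cofactor N j j
             + of_nat (e * (a + b)) * cofactor N j (n + j)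
             + of_nat (e * (a + b)) * cofactor N (n + j) j
             + (of_nat e ^ 2 + of_nat b ^ 2) * cofactor N (n + j) (n + j))
      + ((of_nat e ^ 2 + of_nat a ^ 2) * (of_nat e ^ 2 + of_nat b ^ 2) - of_nat (e * (a + b)) ^ 2)
        * det (mat_delete (mat_delete N (n + j) (n + j)) j j)"
  proof -
    define K where "K i l = C $$ (i, 0) * transpose_mat C $$ (0, l)
      + C $$ (i, 1) * transpose_mat C $$ (1, l)" for i l
    have fst_L: "fst (L ! j)" "\<not> fst (L ! (n + j))"
      using jn by (simp_all add: L_def nth_vertex_labels n_def)
    have C_ix: "C $$ (j, 0) = - of_nat e" "C $$ (j, Suc 0) = - of_nat a"
      "C $$ (n + j, 0) = - of_nat b" "C $$ (n + j, Suc 0) = - of_nat e"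
      using jn by (simp_all add: C_def new L_v fst_L of_nat_poly)
    have C: "C \<in> carrier_mat (2 * n) 2" by (simp add: C_def)
    have K_C: "K i l = C $$ (i, 0) * C $$ (l, 0) + C $$ (i, 1) * C $$ (l, 1)" if "l < 2 * n" for i l
      using C that by (simp add: K_def)
    have K_ix: "K j j = of_nat e ^ 2 + of_nat a ^ 2" "K j (n + j) = of_nat (e * (a + b))"
      "K (n + j) j = of_nat (e * (a + b))" "K (n + j) (n + j) = of_nat e ^ 2 + of_nat b ^ 2"
      using jn by (simp_all add: K_C C_ix power2_eq_square distrib_left mult.commute)
    have C0: "C $$ (i, k) = 0" if "i < 2 * n" "k < 2" "i \<noteq> j" "i \<noteq> n + j" for i k
      using that by (simp add: C_def new L_v)
    show ?thesis
      by (subst det_bordered_by_two[OF N, of j "n + j" x C "transpose_mat C" K])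
        (use jn C C0 K_ix in \<open>simp_all add: x_def K_def power2_eq_square\<close>)
  qed
  \<comment> \<open>Lagrange's identity, that is \<open>det (B B\<^sup>T) = (det B)\<^sup>2\<close>.\<close>
  also have "(of_nat e ^ 2 + of_nat a ^ 2) * (of_nat e ^ 2 + of_nat b ^ 2) - of_nat (e * (a + b)) ^ 2
      = (of_nat (e ^ 2) - of_nat (a * b) :: real poly) ^ 2"
    by (simp add: power2_eq_square algebra_simps)
  also have "det (mat_delete (mat_delete N (n + j) (n + j)) j j)
      = char_poly (mat_delete (mat_delete M (n + j) (n + j)) j j)"
    using M jn mat_delete_carrier[OF M, of "n + j" "n + j"]
    by (simp add: N_def char_poly_def char_poly_matrix_mat_delete[where m = "2 * n"]
        char_poly_matrix_mat_delete[where m = "2 * n - 1"])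
  \<comment> \<open>The sign of a cofactor at \<open>(j, n + j)\<close> or \<open>(n + j, j)\<close> is \<open>(-1)\<close> to the power
    \<open>n + 2 j\<close>, that is \<open>(-1)\<close> to the power \<open>n\<close>.\<close>
  finally show ?thesis
    using M jn
    by (simp add: H_def[symmetric] cofactor_def char_poly_minor_def[symmetric] N_def
        char_poly_minor_same[where m = "2 * n"] char_poly_def[symmetric] power_add
        algebra_simps power2_eq_square flip: mult_2)
qed

theorem theorem5p2:
  fixes G :: "'v mixed_graph" and vs :: "'v list" and u v :: 'v and j n :: nat
    and M :: "real mat" and x :: "real poly"
  assumes "wf_mixed_graph G"
    and "vertex_enum G vs"
    and "n = length vs"
    and "j < n"
    and "v = vs ! j"
    and "u \<notin> verts G"
    and "M = integrated_adjacency G vs"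
    and "x = [:0, 1:]"
  shows
    "(\<forall>H ws. H = add_vertex G u {#} {#(v, u)#} \<and> vertex_enum H ws \<longrightarrow>
        char_poly (integrated_adjacency H ws) =
          x ^ 2 * char_poly M - x * char_poly (mat_delete M j j))
     \<and>
     (\<forall>H ws. H = add_vertex G u {#} {#(u, v)#} \<and> vertex_enum H ws \<longrightarrow>
        char_poly (integrated_adjacency H ws) =
          x ^ 2 * char_poly M - x * char_poly (mat_delete M (n + j) (n + j)))
     \<and>
     (\<forall>H ws us. H = add_vertex G u {#Upair u v#} {#} \<and> vertex_enum H ws
          \<and> vertex_enum (delete_vertex G v) us \<longrightarrow>
        char_poly (integrated_adjacency H ws) =
          x ^ 2 * char_poly M
          - x * (char_poly (mat_delete M j j) + char_poly (mat_delete M (n + j) (n + j)))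
          + char_poly (integrated_adjacency (delete_vertex G v) us))
     \<and>
     (\<forall>H ws us. H = add_vertex G u {#} {#(v, u), (u, v)#} \<and> vertex_enum H ws
          \<and> vertex_enum (delete_vertex G v) us \<longrightarrow>
        char_poly (integrated_adjacency H ws) =
          x ^ 2 * char_poly M
          - x * (char_poly (mat_delete M j j) + char_poly (mat_delete M (n + j) (n + j)))
          + char_poly (integrated_adjacency (delete_vertex G v) us))
     \<and>
     (\<forall>H ws us. H = add_vertex G u {#Upair u v#} {#(v, u)#} \<and> vertex_enum H ws
          \<and> vertex_enum (delete_vertex G v) us \<longrightarrow>
        char_poly (integrated_adjacency H ws) =
          x ^ 2 * char_poly M
          - x * (2 * char_poly (mat_delete M j j) + char_poly (mat_delete M (n + j) (n + j))
                 + (-1) ^ n * char_poly_minor M (n + j) j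
                 + (-1) ^ n * char_poly_minor M j (n + j))
          + char_poly (integrated_adjacency (delete_vertex G v) us))
     \<and>
     (\<forall>H ws us. H = add_vertex G u {#Upair u v#} {#(u, v)#} \<and> vertex_enum H ws
          \<and> vertex_enum (delete_vertex G v) us \<longrightarrow>
        char_poly (integrated_adjacency H ws) =
          x ^ 2 * char_poly M
          - x * (char_poly (mat_delete M j j) + 2 * char_poly (mat_delete M (n + j) (n + j))
                 + (-1) ^ n * char_poly_minor M (n + j) j
                 + (-1) ^ n * char_poly_minor M j (n + j))
          + char_poly (integrated_adjacency (delete_vertex G v) us))
     \<and>
     (\<forall>H ws. H = add_vertex G u {#Upair u v#} {#(v, u), (u, v)#} \<and> vertex_enum H ws \<longrightarrow>
        char_poly (integrated_adjacency H ws) =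
          x ^ 2 * char_poly M
          - 2 * x * (char_poly (mat_delete M j j) + char_poly (mat_delete M (n + j) (n + j))
                     + (-1) ^ n * char_poly_minor M (n + j) j
                     + (-1) ^ n * char_poly_minor M j (n + j)))"
  proof -
  have vs: "vertex_enum G vs" "j < length vs" using assms by auto
  have general: "char_poly (integrated_adjacency H ws) =
      x ^ 2 * char_poly M
      - x * (of_nat (e ^ 2 + a ^ 2) * char_poly (mat_delete M j j)
             + of_nat (e ^ 2 + b ^ 2) * char_poly (mat_delete M (n + j) (n + j))
             + of_nat (e * (a + b)) * ((-1) ^ n * char_poly_minor M (n + j) j
                                     + (-1) ^ n * char_poly_minor M j (n + j)))
      + (of_nat (e ^ 2) - of_nat (a * b)) ^ 2
        * char_poly (mat_delete (mat_delete M (n + j) (n + j)) j j)"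
    if "H = add_vertex G u E A" "vertex_enum H ws" "E = replicate_mset e (Upair u v)"
      "A = replicate_mset a (v, u) + replicate_mset b (u, v)" for H E A ws e a b
    using char_poly_add_vertex[OF assms(1) vs assms(6), of e a b ws] that
    by (simp only: assms)
  have deleted: "char_poly (integrated_adjacency (delete_vertex G v) us)
      = char_poly (mat_delete (mat_delete M (n + j) (n + j)) j j)"
    if "vertex_enum (delete_vertex G v) us" for us
    using char_poly_delete_vertex[OF vs, of us] that by (simp only: assms)
  \<comment> \<open>The numbers in the instances are those of edges, of arcs from \<open>v\<close> to \<open>u\<close>, and of arcs
    from \<open>u\<close> to \<open>v\<close>.\<close>
  show ?thesis
  proof ((intro conjI allI impI; elim conjE), goal_cases)
    case 1
    then show ?case using general[OF 1(1,2), of 0 1 0] by simp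
  next
    case 2
    then show ?case using general[OF 2(1,2), of 0 0 1] by simp
  next
    case 3
    then show ?case using general[OF 3(1,2), of 1 0 0] deleted[OF 3(3)] by simp
  next
    case 4
    then show ?case using general[OF 4(1,2), of 0 1 1] deleted[OF 4(3)] by simp
  next
    case 5
    then show ?case using general[OF 5(1,2), of 1 1 0] deleted[OF 5(3)] by (simp add: add.assoc)
  next
    case 6
    then show ?case using general[OF 6(1,2), of 1 0 1] deleted[OF 6(3)] by (simp add: add.assoc)
  next
    case 7
    then show ?case using general[OF 7(1,2), of 1 1 1] by (simp add: algebra_simps)
  qed
qed

end
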